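(* For each $b \in \mathbb{N} \cup \{\infty\}$, there exists an atomic Puiseux monoid $M$ such that $|\mathrm{Betti}(M)| = b$ (where $|\mathrm{Betti}(M)| = \infty$ means that $\mathrm{Betti}(M)$ is infinite).
   Context: $\mathbb{N}$ is the set of positive integers. A Puiseux monoid is an additive submonoid of $\mathbb{Q}_{\ge 0}$ (so its only invertible element is $0$). Let $M$ be a Puiseux monoid. An atom of $M$ is a nonzero element that is not the sum of two nonzero elements of $M$; $\mathcal{A}(M)$ is the set of atoms. $M$ is atomic if every nonzero element is a finite sum of atoms (repetitions allowed). A factorization is an element of the free commutative monoid on $\mathcal{A}(M)$ (a formal sum of atoms), and $\mathsf{Z}(x)$ is the set of factorizations whose sum in $M$ is $x$. The Betti graph $\nabla_x$ of $x \in M$ has vertex set $\mathsf{Z}(x)$ and an edge between distinct $z,z' \in \mathsf{Z}(x)$ exactly when $z$ and $z'$ have at least one atom in common. An element $x\in M$ is a Betti element if $\nabla_x$ is disconnected (has at least two connected components); $\mathrm{Betti}(M)$ is the set of Betti elements of $M$. *)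

theory Defs
  imports "HOL.Rat" "HOL-Library.Multiset" "HOL-Library.Extended_Nat"
    "Graph_Theory.Digraph_Component"
begin

definition puiseux_monoid :: "rat set \<Rightarrow> bool" where
  "puiseux_monoid M \<longleftrightarrow>
     (\<forall>x\<in>M. 0 \<le> x) \<and> 0 \<in> M \<and> (\<forall>x\<in>M. \<forall>y\<in>M. x + y \<in> M)"

definition atoms :: "rat set \<Rightarrow> rat set" where
  "atoms M = {a \<in> M. a \<noteq> 0 \<and> \<not> (\<exists>x\<in>M. \<exists>y\<in>M. x \<noteq> 0 \<and> y \<noteq> 0 \<and> a = x + y)}"

(* The free commutative monoid on the atoms consists of the finite multisets of atoms;
   sum_mset is its canonical evaluation homomorphism into M. *)
definition factorizations :: "rat set \<Rightarrow> rat \<Rightarrow> rat multiset set" where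
  "factorizations M x = {z. set_mset z \<subseteq> atoms M \<and> sum_mset z = x}"

definition atomic_monoid :: "rat set \<Rightarrow> bool" where
  "atomic_monoid M \<longleftrightarrow> (\<forall>x\<in>M. x \<noteq> 0 \<longrightarrow> factorizations M x \<noteq> {})"

(* An undirected edge is represented by the two arcs between its endpoints. *)
definition betti_graph :: "rat set \<Rightarrow> rat \<Rightarrow> rat multiset pair_pre_digraph" where
  "betti_graph M x =
     \<lparr> pverts = factorizations M x,
       parcs = {(z, z'). z \<in> factorizations M x \<and> z' \<in> factorizations M x \<and>
                  z \<noteq> z' \<and> (\<exists>a. a \<in># z \<and> a \<in># z')} \<rparr>"

(* The library's "connected" is false for the graph without vertices, which has no
   connected component; hence the first conjunct about the graph. *)
definition Betti :: "rat set \<Rightarrow> rat set" where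
  "Betti M = {x \<in> M. pverts (betti_graph M x) \<noteq> {} \<and>
                \<not> Digraph_Component.connected (with_proj (betti_graph M x))}"

end

theory Submission
  imports Defs
begin

text \<open>
  For an initial segment \<open>I\<close> of the naturals let \<open>M\<close> be generated by the powers
  \<open>(3/2)\<^sup>i\<close> with \<open>i \<in> I\<close>; comparing powers of 2 in denominators shows that these are its atoms.
  The factorization \<open>2 (3/2)\<^sup>i\<^sup>+\<^sup>1\<close> shares no atom with any other factorization of the same element,
  one of which is \<open>3 (3/2)\<^sup>i\<close>, so these elements are Betti.
  In a factorization of any other element, replacing \<open>2 (3/2)\<^sup>i\<^sup>+\<^sup>1\<close> by \<open>3 (3/2)\<^sup>i\<close> keeps an atom, so
  it stays within a connected component. Since this lengthens factorizations it ends at one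
  in which \<open>(3/2)\<^sup>i\<^sup>+\<^sup>1\<close> occurs at most once, and any two such share an atom.
  Hence the Betti elements correspond to the \<open>i\<close> with \<open>i + 1 \<in> I\<close>.
\<close>

section \<open>Connectedness of the Betti graph as mutual reachability\<close>

lemma parcs_betti_graph_sym:
  "(u, v) \<in> parcs (betti_graph M x) \<Longrightarrow> (v, u) \<in> parcs (betti_graph M x)"
  by (auto simp: betti_graph_def)

lemma rtrancl_on_betti_graph_sym:
  assumes "(u, v) \<in> rtrancl_on (factorizations M x) (parcs (betti_graph M x))"
  shows "(v, u) \<in> rtrancl_on (factorizations M x) (parcs (betti_graph M x))"
proof -
  have "(parcs (betti_graph M x))\<inverse> = parcs (betti_graph M x)"
    by (auto intro: parcs_betti_graph_sym)
  then show ?thesis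
    using rtrancl_on_converseI[OF assms] by simp
qed

text \<open>Connectedness of a digraph is strong connectedness of its symmetric closure; the arcs
  here are already symmetric, so the closure adds nothing.\<close>

lemma connected_betti_graph_iff:
  "Digraph_Component.connected (with_proj (betti_graph M x)) \<longleftrightarrow>
     factorizations M x \<noteq> {} \<and>
     (\<forall>u\<in>factorizations M x. \<forall>v\<in>factorizations M x.
        (u, v) \<in> rtrancl_on (factorizations M x) (parcs (betti_graph M x)))"
proof -
  have "parcs (mk_symmetric (with_proj (betti_graph M x))) = parcs (betti_graph M x)"
    by (auto simp: parcs_mk_symmetric dest: parcs_betti_graph_sym)
  moreover have "pverts (betti_graph M x) = factorizations M x"
    by (simp add: betti_graph_def)
  ultimately show ?thesis
    by (simp add: connected_def strongly_connected_def reachable_def)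
qed

section \<open>Generators, their sums and denominators\<close>

definition gen :: "nat \<Rightarrow> rat" where
  "gen i = (3/2) ^ i"

definition gen_monoid :: "nat set \<Rightarrow> rat set" where
  "gen_monoid I = {sum_mset z | z. set_mset z \<subseteq> gen ` I}"

lemma gen_Suc: "2 * gen (Suc i) = 3 * gen i"
  by (simp add: gen_def)

lemma gen_ge_1: "1 \<le> gen i"
  by (simp add: gen_def)

lemma gen_pos: "0 < gen i"
  by (simp add: gen_def)

lemma gen_less_iff [simp]: "gen i < gen j \<longleftrightarrow> i < j"
  by (simp add: gen_def)

lemma gen_eq_iff [simp]: "gen i = gen j \<longleftrightarrow> i = j"
  by (simp add: gen_def)

text \<open>Every generator is at least 1. This bounds the length of all factorizations of a fixed
  element, which later makes the rewriting terminate.\<close>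

lemma size_le_sum_mset:
  assumes "set_mset z \<subseteq> gen ` I"
  shows "of_nat (size z) \<le> sum_mset z"
  using assms
proof (induction z)
  case (add a z)
  then obtain i where "a = gen i" by auto
  then show ?case using add gen_ge_1[of i] by auto
qed simp

lemma sum_mset_gen_nonneg:
  assumes "set_mset z \<subseteq> gen ` I"
  shows "0 \<le> sum_mset z"
  using size_le_sum_mset[OF assms] by (meson of_nat_0_le_iff order_trans)

lemma sum_mset_gen_zero_iff:
  assumes "set_mset z \<subseteq> gen ` I"
  shows "sum_mset z = 0 \<longleftrightarrow> z = {#}"
  using size_le_sum_mset[OF assms] by auto

lemma pow2_sum_mset_int:
  assumes "set_mset z \<subseteq> gen ` {..n}"
  shows "2 ^ n * sum_mset z \<in> \<int>"
  using assms
proof (induction z)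
  case (add a z)
  then obtain i where i: "a = gen i" "i \<le> n" by auto
  then obtain k where "n = i + k" by (auto simp: le_iff_add)
  with i have "2 ^ n * a = 3 ^ i * 2 ^ k"
    by (simp add: gen_def power_add power_divide)
  then have "2 ^ n * a \<in> \<int>" by simp
  then show ?case using add by (simp add: distrib_left)
qed simp

text \<open>Twice this number is a power of 3, hence odd.\<close>

lemma pow2_gen_Suc_not_int: "2 ^ n * gen (Suc n) \<notin> \<int>"
proof
  assume "2 ^ n * gen (Suc n) \<in> \<int>"
  then obtain k where "2 ^ n * gen (Suc n) = of_int k" by (auto elim: Ints_cases)
  moreover have "2 * (2 ^ n * gen (Suc n)) = 3 ^ Suc n"
    by (simp add: gen_def power_divide)
  ultimately have "of_int (2 * k) = (of_int (3 ^ Suc n) :: rat)" by simp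
  then have "2 * k = 3 ^ Suc n" by (simp only: of_int_eq_iff)
  then have "even ((3::int) ^ Suc n)" by (metis dvd_triv_left)
  then show False by simp
qed

lemma gen_Suc_neq_sum_mset:
  assumes "set_mset z \<subseteq> gen ` {..n}"
  shows "sum_mset z \<noteq> gen (Suc n)"
  using pow2_sum_mset_int[OF assms] pow2_gen_Suc_not_int[of n] by auto

text \<open>If \<open>gen i\<close> occurs in \<open>z\<close>, the remaining terms sum to 0, so
  there are none. Otherwise all terms have smaller index, and their sum has too small a power of 2
  in its denominator; for \<open>i = 0\<close> no terms are left at all.\<close>

lemma sum_mset_eq_gen:
  assumes z: "set_mset z \<subseteq> gen ` I" and eq: "sum_mset z = gen i"
  shows "z = {#gen i#}"
proof (cases "gen i \<in># z")
  case True
  then obtain r where r: "z = add_mset (gen i) r" by (meson multi_member_split)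
  then show ?thesis using z eq sum_mset_gen_zero_iff[of r I] by auto
next
  case False
  have less: "j < i" if "gen j \<in># z" for j
  proof -
    obtain r where r: "z = add_mset (gen j) r" using \<open>gen j \<in># z\<close> by (meson multi_member_split)
    then have "gen j \<le> gen i" using z eq sum_mset_gen_nonneg[of r I] by auto
    then show "j < i" using False that
      by (metis gen_eq_iff gen_less_iff order_le_less)
  qed
  show ?thesis
  proof (cases i)
    case 0
    then have "z = {#}" using less z by (metis imageE less_nat_zero_code multiset_nonemptyE subsetD)
    then show ?thesis using eq gen_pos[of i] by simp
  next
    case (Suc n)
    then have "set_mset z \<subseteq> gen ` {..n}" using less z by fastforce
    then show ?thesis using gen_Suc_neq_sum_mset eq Suc by blast
  qed
qed

section \<open>The generated monoid and its atoms\<close>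

lemma puiseux_gen_monoid: "puiseux_monoid (gen_monoid I)"
  unfolding puiseux_monoid_def
proof (intro conjI ballI)
  show "0 \<in> gen_monoid I" by (auto simp: gen_monoid_def intro!: exI[of _ "{#}"])
  show "0 \<le> x" if "x \<in> gen_monoid I" for x
    using that sum_mset_gen_nonneg by (auto simp: gen_monoid_def)
  show "x + y \<in> gen_monoid I" if xy: "x \<in> gen_monoid I" "y \<in> gen_monoid I" for x y
  proof -
    obtain u v where "x = sum_mset u" "y = sum_mset v" "set_mset u \<subseteq> gen ` I" "set_mset v \<subseteq> gen ` I"
      using xy by (auto simp: gen_monoid_def)
    then show ?thesis by (auto simp: gen_monoid_def intro!: exI[of _ "u + v"])
  qed
qed

lemma gen_in_gen_monoid: "i \<in> I \<Longrightarrow> gen i \<in> gen_monoid I"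
  by (auto simp: gen_monoid_def intro!: exI[of _ "{#gen i#}"])

lemma atoms_gen_monoid: "atoms (gen_monoid I) = gen ` I"
proof (intro equalityI subsetI)
  fix a assume "a \<in> atoms (gen_monoid I)"
  then have a: "a \<in> gen_monoid I" "a \<noteq> 0"
    and irr: "\<And>x y. \<lbrakk>x \<in> gen_monoid I; y \<in> gen_monoid I; x \<noteq> 0; y \<noteq> 0\<rbrakk> \<Longrightarrow> a \<noteq> x + y"
    by (auto simp: atoms_def)
  obtain z where z: "a = sum_mset z" "set_mset z \<subseteq> gen ` I"
    using a by (auto simp: gen_monoid_def)
  then obtain i r where i: "z = add_mset (gen i) r" "i \<in> I" "set_mset r \<subseteq> gen ` I"
    using \<open>a \<noteq> 0\<close> by (cases z) auto
  \<comment> \<open>One generator is split off; irreducibility of \<open>a\<close> forces the rest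
    to vanish.\<close>
  have "sum_mset r \<in> gen_monoid I" using i by (auto simp: gen_monoid_def)
  then have "sum_mset r = 0"
    using irr[of "gen i" "sum_mset r"] gen_in_gen_monoid[of i I] i z gen_pos[of i] by auto
  then show "a \<in> gen ` I" using z i by simp
next
  fix a assume "a \<in> gen ` I"
  then obtain i where i: "a = gen i" "i \<in> I" by auto
  have "gen i \<noteq> x + y" if xy: "x \<in> gen_monoid I" "y \<in> gen_monoid I" "x \<noteq> 0" "y \<noteq> 0" for x y
  proof
    assume eq: "gen i = x + y"
    obtain u v where uv: "x = sum_mset u" "y = sum_mset v"
        "set_mset u \<subseteq> gen ` I" "set_mset v \<subseteq> gen ` I"
      using xy by (auto simp: gen_monoid_def)
    then have "u + v = {#gen i#}"
      using eq by (intro sum_mset_eq_gen[of _ I]) auto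
    then have "u = {#} \<or> v = {#}" by (metis union_is_single)
    then show False using uv xy by auto
  qed
  then show "a \<in> atoms (gen_monoid I)"
    using i gen_in_gen_monoid[of i I] gen_pos[of i] by (auto simp: atoms_def)
qed

lemma factorizations_gen_monoid:
  "factorizations (gen_monoid I) x = {z. set_mset z \<subseteq> gen ` I \<and> sum_mset z = x}"
  by (simp add: factorizations_def atoms_gen_monoid)

lemma factorizations_gen_monoid_nonempty:
  "factorizations (gen_monoid I) x \<noteq> {} \<longleftrightarrow> x \<in> gen_monoid I"
  unfolding factorizations_gen_monoid by (auto simp: gen_monoid_def)

lemma atomic_gen_monoid: "atomic_monoid (gen_monoid I)"
  by (simp add: atomic_monoid_def factorizations_gen_monoid_nonempty)

section \<open>Elements with an isolated factorization\<close>

lemma factorization_double_gen_isolated: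
  assumes z: "z \<in> factorizations (gen_monoid I) (2 * gen i)" and mem: "gen i \<in># z"
  shows "z = {#gen i, gen i#}"
proof -
  obtain r where r: "z = add_mset (gen i) r" using mem by (meson multi_member_split)
  \<comment> \<open>The rest sums to \<open>gen i\<close>, which has only the trivial
    factorization.\<close>
  then have "r = {#gen i#}"
    using z by (intro sum_mset_eq_gen[of _ I]) (auto simp: factorizations_gen_monoid)
  with r show ?thesis by simp
qed

lemma double_gen_in_Betti:
  assumes "i \<in> I" "Suc i \<in> I"
  shows "2 * gen (Suc i) \<in> Betti (gen_monoid I)"
proof -
  let ?M = "gen_monoid I" and ?x = "2 * gen (Suc i)"
  let ?u = "{#gen (Suc i), gen (Suc i)#}" and ?v = "{#gen i, gen i, gen i#}"
  let ?Z = "factorizations ?M ?x"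
  have u: "?u \<in> ?Z" using assms by (simp add: factorizations_gen_monoid)
  have v: "?v \<in> ?Z" using assms gen_Suc[of i] by (simp add: factorizations_gen_monoid)
  have M: "?x \<in> ?M" using u factorizations_gen_monoid_nonempty by blast
  \<comment> \<open>All atoms of \<open>?u\<close> equal \<open>gen (Suc i)\<close>, so a neighbour
    contains that atom and is \<open>?u\<close> itself. Hence \<open>?v\<close>, of length 3 instead
    of 2, is out of reach.\<close>
  have stuck: "w = ?u" if "(?u, w) \<in> rtrancl_on ?Z (parcs (betti_graph ?M ?x))" for w
    using that
  proof (induction rule: rtrancl_on_induct)
    case (step y z)
    then have "gen (Suc i) \<in># z" by (auto simp: betti_graph_def)
    then show ?case using step factorization_double_gen_isolated by blast
  qed simp
  have "(?u, ?v) \<notin> rtrancl_on ?Z (parcs (betti_graph ?M ?x))"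
  proof
    assume "(?u, ?v) \<in> rtrancl_on ?Z (parcs (betti_graph ?M ?x))"
    then have "size ?v = size ?u" using stuck by metis
    then show False by simp
  qed
  then have "\<not> Digraph_Component.connected (with_proj (betti_graph ?M ?x))"
    using u v unfolding connected_betti_graph_iff by blast
  then show ?thesis using M u by (auto simp: Betti_def betti_graph_def)
qed

section \<open>Reduced factorizations and connectedness of the other Betti graphs\<close>

definition reduced :: "rat multiset \<Rightarrow> bool" where
  "reduced z \<longleftrightarrow> (\<forall>i. count z (gen (Suc i)) \<le> 1)"

text \<open>Multiplication by \<open>2 ^ m\<close>, where \<open>n = Suc m\<close>, makes every term
  integral except \<open>gen n\<close>. Since \<open>z\<close> is reduced, it contains
  \<open>gen n\<close> exactly once, so its scaled sum is not an integer, whereas without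
  \<open>gen n\<close> that of \<open>w\<close> would be. The multiplicity of \<open>gen 0\<close>
  is unrestricted, but for \<open>n = 0\<close> it is the only generator available.\<close>

lemma reduced_top_shared:
  assumes z: "reduced z" "set_mset z \<subseteq> gen ` {..n}" and w: "set_mset w \<subseteq> gen ` {..n}"
    and eq: "sum_mset z = sum_mset w" and top: "gen n \<in># z"
  shows "gen n \<in># w"
proof (cases n)
  case 0
  have "w \<noteq> {#}"
    using sum_mset_gen_zero_iff[OF z(2)] eq top by auto
  then show ?thesis using w 0 by (cases w) auto
next
  case (Suc m)
  show ?thesis
  proof (rule ccontr)
    assume nw: "gen n \<notin># w"
    obtain r where r: "z = add_mset (gen n) r" using top by (meson multi_member_split)
    then have nr: "gen n \<notin># r"
      using z(1) Suc by (auto simp: reduced_def not_in_iff dest: spec[of _ m])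
    have low: "set_mset y \<subseteq> gen ` {..m}" if "set_mset y \<subseteq> gen ` {..n}" "gen n \<notin># y" for y
      using that Suc by (fastforce simp: le_Suc_eq)
    have "2 ^ m * sum_mset w \<in> \<int>" "2 ^ m * sum_mset r \<in> \<int>"
      using z(2) w r nw nr by (simp_all add: pow2_sum_mset_int low)
    then have "2 ^ m * sum_mset w - 2 ^ m * sum_mset r \<in> \<int>" by (rule Ints_diff)
    moreover have "2 ^ m * sum_mset w - 2 ^ m * sum_mset r = 2 ^ m * gen n"
      using eq[symmetric] r by (simp add: algebra_simps)
    ultimately show False using pow2_gen_Suc_not_int[of m] Suc by simp
  qed
qed

text \<open>The atom of largest index in either factorization lies in both:
  \<open>reduced_top_shared\<close> applies from whichever side contains it.\<close>

lemma reduced_share_atom: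
  assumes z: "reduced z" "set_mset z \<subseteq> gen ` I" and w: "reduced w" "set_mset w \<subseteq> gen ` I"
    and eq: "sum_mset z = sum_mset w" and ne: "z \<noteq> {#}"
  shows "\<exists>a. a \<in># z \<and> a \<in># w"
proof -
  define J where "J = {i. gen i \<in># z + w}"
  have "inj gen" by (simp add: inj_def)
  have "J = gen -` set_mset (z + w)" by (auto simp: J_def)
  then have fin: "finite J" using \<open>inj gen\<close> by (simp add: finite_vimageI)
  have "J \<noteq> {}" using ne z(2) by (cases z) (auto simp: J_def)
  define n where "n = Max J"
  have n: "gen n \<in># z \<or> gen n \<in># w"
    using Max_in[OF fin \<open>J \<noteq> {}\<close>] by (auto simp: n_def J_def)
  have "i \<le> n" if "gen i \<in># z + w" for i
    using that fin by (auto simp: n_def J_def)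
  then have "set_mset z \<subseteq> gen ` {..n}" "set_mset w \<subseteq> gen ` {..n}"
    using z(2) w(2) by fastforce+
  then show ?thesis
    using n reduced_top_shared z(1) w(1) eq by metis
qed

text \<open>Each replacement of two copies of \<open>gen (Suc i)\<close> by three of
  \<open>gen i\<close> adds one to the length, which is at most \<open>x\<close>; the induction is
  on the remaining gap. Downward closure of \<open>I\<close> makes \<open>gen i\<close>
  available.\<close>

lemma reachable_reduced:
  assumes down: "\<And>i. Suc i \<in> I \<Longrightarrow> i \<in> I"
    and x: "x \<notin> (\<lambda>i. 2 * gen (Suc i)) ` {i. Suc i \<in> I}"
    and z: "z \<in> factorizations (gen_monoid I) x"
  shows "\<exists>w. reduced w \<and>
    (z, w) \<in> rtrancl_on (factorizations (gen_monoid I) x) (parcs (betti_graph (gen_monoid I) x))"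
  using z
proof (induction "nat \<lfloor>x\<rfloor> - size z" arbitrary: z rule: less_induct)
  case less
  let ?Z = "factorizations (gen_monoid I) x" and ?E = "parcs (betti_graph (gen_monoid I) x)"
  show ?case
  proof (cases "reduced z")
    case True
    then show ?thesis using less.prems by auto
  next
    case False
    then obtain i where "2 \<le> count z (gen (Suc i))"
      by (auto simp: reduced_def not_le Suc_le_eq numeral_2_eq_2)
    then have "replicate_mset 2 (gen (Suc i)) \<subseteq># z"
      by (simp add: count_le_replicate_mset_subset_eq)
    then obtain r where r: "z = r + {#gen (Suc i), gen (Suc i)#}"
      by (auto simp: numeral_2_eq_2 subset_mset.le_iff_add)
    define z' where "z' = r + {#gen i, gen i, gen i#}"
    have I: "Suc i \<in> I" "i \<in> I"
      using r less.prems down by (auto simp: factorizations_gen_monoid)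
    have z': "z' \<in> ?Z"
      using less.prems r I gen_Suc[of i] by (auto simp: z'_def factorizations_gen_monoid)
    \<comment> \<open>The excluded values of \<open>x\<close> are exactly those where nothing might
      survive the replacement; an atom of \<open>r\<close> is common to \<open>z\<close> and
      \<open>z'\<close> and gives the edge.\<close>
    have "r \<noteq> {#}"
    proof
      assume "r = {#}"
      then have "x = 2 * gen (Suc i)" using r less.prems by (simp add: factorizations_gen_monoid)
      then show False using x I by blast
    qed
    then obtain a where "a \<in># r" by (meson multiset_nonemptyE)
    moreover have "size z' = Suc (size z)" by (simp add: r z'_def)
    moreover from this have "z \<noteq> z'" by auto
    ultimately have edge: "(z, z') \<in> ?E"
      using less.prems z' unfolding betti_graph_def r z'_def by auto
    \<comment> \<open>Subtraction on naturals truncates at 0, so the measure drops strictly only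
      because \<open>size z'\<close> still respects the bound.\<close>
    have "of_nat (size z') \<le> x"
      using z' size_le_sum_mset by (auto simp: factorizations_gen_monoid)
    then have "size z' \<le> nat \<lfloor>x\<rfloor>"
      by (simp add: le_floor_iff le_nat_iff)
    then have "nat \<lfloor>x\<rfloor> - size z' < nat \<lfloor>x\<rfloor> - size z"
      using \<open>size z' = Suc (size z)\<close> by simp
    then obtain w where "reduced w" "(z', w) \<in> rtrancl_on ?Z ?E"
      using less.hyps z' by blast
    then show ?thesis
      using converse_rtrancl_on_into_rtrancl_on[OF edge] less.prems by blast
  qed
qed

lemma Betti_gen_monoid:
  assumes down: "\<And>i. Suc i \<in> I \<Longrightarrow> i \<in> I"
  shows "Betti (gen_monoid I) = (\<lambda>i. 2 * gen (Suc i)) ` {i. Suc i \<in> I}"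
proof (intro equalityI subsetI)
  fix x assume "x \<in> (\<lambda>i. 2 * gen (Suc i)) ` {i. Suc i \<in> I}"
  then show "x \<in> Betti (gen_monoid I)" using down double_gen_in_Betti by auto
next
  fix x assume B: "x \<in> Betti (gen_monoid I)"
  let ?Z = "factorizations (gen_monoid I) x" and ?E = "parcs (betti_graph (gen_monoid I) x)"
  show "x \<in> (\<lambda>i. 2 * gen (Suc i)) ` {i. Suc i \<in> I}"
  proof (rule ccontr)
    assume x: "x \<notin> (\<lambda>i. 2 * gen (Suc i)) ` {i. Suc i \<in> I}"
    have "(u, v) \<in> rtrancl_on ?Z ?E" if u: "u \<in> ?Z" and v: "v \<in> ?Z" for u v
    proof -
      obtain u' where u': "reduced u'" "(u, u') \<in> rtrancl_on ?Z ?E"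
        using reachable_reduced[OF down x u] by blast
      obtain v' where v': "reduced v'" "(v, v') \<in> rtrancl_on ?Z ?E"
        using reachable_reduced[OF down x v] by blast
      have Z: "u' \<in> ?Z" "v' \<in> ?Z"
        using u' v' in_rtrancl_on_in_F by fast+
      have "(u', v') \<in> rtrancl_on ?Z ?E"
      proof (cases "u' = v'")
        case False
        have sub: "set_mset u' \<subseteq> gen ` I" "set_mset v' \<subseteq> gen ` I" "sum_mset u' = sum_mset v'"
          using Z by (auto simp: factorizations_gen_monoid)
        \<comment> \<open>If \<open>u'\<close> were empty, the common sum would be 0 and
          \<open>v'\<close> empty too, contrary to \<open>u' \<noteq> v'\<close>.\<close>
        then have "u' \<noteq> {#}"
          using False sum_mset_gen_zero_iff[OF sub(2)] by auto
        then have "(u', v') \<in> ?E"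
          using reduced_share_atom[OF u'(1) sub(1) v'(1) sub(2,3)] False Z
          by (auto simp: betti_graph_def)
        then show ?thesis
          using Z by (meson rtrancl_on_into_rtrancl_on rtrancl_on_refl)
      qed (use Z in simp)
      then show ?thesis
        using u'(2) rtrancl_on_betti_graph_sym[OF v'(2)] by (meson rtrancl_on_trans)
    qed
    then have "Digraph_Component.connected (with_proj (betti_graph (gen_monoid I) x))"
      using B factorizations_gen_monoid_nonempty
      by (auto simp: connected_betti_graph_iff Betti_def)
    then show False using B by (simp add: Betti_def)
  qed
qed

theorem proposition4p5:
  fixes b :: enat
  assumes "b \<ge> 1"
  shows "\<exists>M. puiseux_monoid M \<and> atomic_monoid M \<and>
    (case b of enat n \<Rightarrow> finite (Betti M) \<and> card (Betti M) = n
             | \<infinity> \<Rightarrow> infinite (Betti M))"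
proof -
  \<comment> \<open>For \<open>b = enat n\<close> these are the \<open>n + 1\<close> indices from 0
    to \<open>n\<close>, which form \<open>n\<close> consecutive pairs; for
    \<open>b = \<infinity>\<close> they are all naturals.\<close>
  define I where "I = {i. enat i \<le> b}"
  have "i \<in> I" if "Suc i \<in> I" for i
    using that by (cases b) (auto simp: I_def)
  then have B: "Betti (gen_monoid I) = (\<lambda>i. 2 * gen (Suc i)) ` {i. Suc i \<in> I}"
    by (rule Betti_gen_monoid)
  have inj: "inj_on (\<lambda>i. 2 * gen (Suc i)) A" for A
    by (auto simp: inj_on_def)
  have "case b of enat n \<Rightarrow> finite (Betti (gen_monoid I)) \<and> card (Betti (gen_monoid I)) = n
             | \<infinity> \<Rightarrow> infinite (Betti (gen_monoid I))"
  proof (cases b)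
    case (enat n)
    then have "{i. Suc i \<in> I} = {..<n}" by (auto simp: I_def)
    then show ?thesis using enat B by (simp add: card_image[OF inj])
  next
    case infinity
    then have "{i. Suc i \<in> I} = UNIV" by (auto simp: I_def)
    then show ?thesis using infinity B by (simp add: finite_image_iff[OF inj])
  qed
  then show ?thesis using puiseux_gen_monoid atomic_gen_monoid by blast
qed

end
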